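(* Let $\mathcal{T}_k\subseteq\mathbb{R}_+^4$ ($k\ge0$) be the sets of feasible tuples $(\rho,\lambda,\mu,\nu)$ defined in the context, let $\delta,c,G\ge0$ be constants, and fix $U_0\ge\mathbb{E}\|x_0-x_\star\|^2$. Let $U_0^{\mathrm{opt}}=U_0$ and, for $k\ge0$, $$U_{k+1}^{\mathrm{opt}}=\inf\Bigl\{U_{k+1}\ :\ U_{t+1}=\rho_t^2U_t+2\lambda_tG^2+\mu_tc^2,\ (\rho_t,\lambda_t,\mu_t,\nu_t)\in\mathcal{T}_t,\ 0\le t\le k\Bigr\},$$ the infimum being over all choices of $\{(\rho_t,\lambda_t,\mu_t,\nu_t)\}_{t=0}^{k}$. Then for all $k\ge0$ $$U_{k+1}^{\mathrm{opt}}=\inf_{(\rho,\lambda,\mu,\nu)\in\mathcal{T}_k}\ \rho^2U_k^{\mathrm{opt}}+2\lambda G^2+\mu c^2 .$$ Consequently the greedy approach, in which one starts from $U_0$ and recursively optimizes $U_{t+1}=\inf_{(\rho,\lambda,\mu,\nu)\in\mathcal{T}_t}\{\rho^2U_t+2\lambda G^2+\mu c^2\}$ in terms of $U_t$ for $t=0,\dots,k-1$, yields a value $U_k$ that equals $U_k^{\mathrm{opt}}$, i.e. is globally optimal over all possible choices of the parameters $(\rho_t,\lambda_t,\mu_t,\nu_t)\in\mathcal{T}_t$.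
   Context: Fix $m>0$, $\delta,c\ge0$, real stepsizes $\alpha_k>0$ ($k\ge0$), a constant $G\ge0$, and a matrix $M=\begin{bmatrix} M_{11} & M_{12} \\ M_{21} & M_{22} \end{bmatrix}$ equal to one of (I) $\begin{bmatrix} -m^2 & m \\ m & -1 \end{bmatrix}$, (II) $\begin{bmatrix} 2L^2 & 0 \\ 0 & -1 \end{bmatrix}$, (III) $\begin{bmatrix} 0 & L \\ L & -1 \end{bmatrix}$, (IV) $\begin{bmatrix} -2mL & L+m \\ L+m & -1 \end{bmatrix}$, with $0<L<\infty$. For each $k$, $\mathcal{T}_k$ is the set of tuples of nonnegative reals $(\rho_k,\lambda_k,\mu_k,\nu_k)$ such that $$\begin{bmatrix} -\rho_k^2 - 2\nu_k m + \lambda_k M_{11} & \nu_k + \lambda_k M_{12} & -1 & 0 \\ \nu_k +\lambda_k M_{21} & \mu_k \delta^2 +\lambda_k M_{22} & \alpha_k & 0 \\ -1 & \alpha_k & -1 & \alpha_k \\ 0 & 0 & \alpha_k & -\mu_k \end{bmatrix}\preceq 0$$ (negative semidefinite). The number $\mathbb{E}\|x_0-x_\star\|^2\ge0$ is the (finite) expected squared initial distance of a stochastic optimization method's initial point $x_0$ to the minimizer $x_\star$; for the purposes of this statement it only serves to give a nonnegative real lower bound on $U_0$. *)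

theory Defs
  imports "HOL-Probability.Probability"
begin

definition negative_semidefinite :: "real^'n^'n \<Rightarrow> bool" where
  "negative_semidefinite A \<longleftrightarrow> transpose A = A \<and> (\<forall>x. x \<bullet> (A *v x) \<le> 0)"

text \<open>The four admissible matrices; the first one does not depend on \<open>L\<close>.\<close>

definition admissible_matrices :: "real \<Rightarrow> real \<Rightarrow> (real^2^2) set" where
  "admissible_matrices m L =
    {vector [vector [- m\<^sup>2, m], vector [m, - 1]],
     vector [vector [2 * L\<^sup>2, 0], vector [0, - 1]],
     vector [vector [0, L], vector [L, - 1]],
     vector [vector [- 2 * m * L, L + m], vector [L + m, - 1]]}"

definition lmi_matrix ::
  "real \<Rightarrow> real \<Rightarrow> real \<Rightarrow> real^2^2 \<Rightarrow> real \<Rightarrow> real \<Rightarrow> real \<Rightarrow> real \<Rightarrow> real^4^4" where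
  "lmi_matrix m \<delta> a M \<rho> lam \<mu> \<nu> =
    vector [
      vector [- \<rho>\<^sup>2 - 2 * \<nu> * m + lam * M $ 1 $ 1, \<nu> + lam * M $ 1 $ 2, - 1, 0],
      vector [\<nu> + lam * M $ 2 $ 1, \<mu> * \<delta>\<^sup>2 + lam * M $ 2 $ 2, a, 0],
      vector [- 1, a, - 1, a],
      vector [0, 0, a, - \<mu>]]"

text \<open>Tuples are ordered as \<open>(\<rho>, lam, \<mu>, \<nu>)\<close>; \<open>a\<close> is the stepsize.\<close>

definition feasible_tuples ::
  "real \<Rightarrow> real \<Rightarrow> real^2^2 \<Rightarrow> real \<Rightarrow> (real \<times> real \<times> real \<times> real) set" where
  "feasible_tuples m \<delta> M a =
    {(\<rho>, lam, \<mu>, \<nu>). 0 \<le> \<rho> \<and> 0 \<le> lam \<and> 0 \<le> \<mu> \<and> 0 \<le> \<nu> \<and>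
       negative_semidefinite (lmi_matrix m \<delta> a M \<rho> lam \<mu> \<nu>)}"

definition bound_step :: "real \<Rightarrow> real \<Rightarrow> real \<Rightarrow> real \<times> real \<times> real \<times> real \<Rightarrow> real" where
  "bound_step G c u = (\<lambda>(\<rho>, lam, \<mu>, \<nu>). \<rho>\<^sup>2 * u + 2 * lam * G\<^sup>2 + \<mu> * c\<^sup>2)"

text \<open>In the following two definitions, \<open>T t\<close> is the set of tuples allowed at step \<open>t\<close>.
  The infimum in \<open>U_opt\<close> is over sequences \<open>\<theta>\<close> of tuples, of which only
  \<open>\<theta> 0, \<dots>, \<theta> k\<close> are constrained and matter for \<open>U (Suc k)\<close>.
  Infima are taken in the reals; for \<open>U0 \<ge> 0\<close> and \<open>T t = feasible_tuples m \<delta> M (\<alpha> t)\<close>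
  all the sets involved are nonempty (\<open>feasible_tuples_nonempty\<close> below) and bounded below by 0.\<close>

fun U_opt ::
  "real \<Rightarrow> real \<Rightarrow> (nat \<Rightarrow> (real \<times> real \<times> real \<times> real) set) \<Rightarrow> real \<Rightarrow> nat \<Rightarrow> real" where
  "U_opt G c T U0 0 = U0"
| "U_opt G c T U0 (Suc k) =
    Inf {U (Suc k) | U \<theta>. U 0 = U0 \<and>
      (\<forall>t\<le>k. \<theta> t \<in> T t \<and> U (Suc t) = bound_step G c (U t) (\<theta> t))}"

fun U_greedy ::
  "real \<Rightarrow> real \<Rightarrow> (nat \<Rightarrow> (real \<times> real \<times> real \<times> real) set) \<Rightarrow> real \<Rightarrow> nat \<Rightarrow> real" where
  "U_greedy G c T U0 0 = U0"
| "U_greedy G c T U0 (Suc t) = (INF \<theta>\<in>T t. bound_step G c (U_greedy G c T U0 t) \<theta>)"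

lemma vector_4:
  "(vector [w, x, y, z] :: 'a::zero^4) $ 1 = w"
  "(vector [w, x, y, z] :: 'a::zero^4) $ 2 = x"
  "(vector [w, x, y, z] :: 'a::zero^4) $ 3 = y"
  "(vector [w, x, y, z] :: 'a::zero^4) $ 4 = z"
  unfolding vector_def by simp_all

lemma feasible_tuples_nonempty:
  assumes "M \<in> admissible_matrices m L"
  shows "feasible_tuples m \<delta> M a \<noteq> {}"
proof -
  define p q where "p = M $ 1 $ 1" and "q = M $ 1 $ 2"
  have M: "M $ 2 $ 1 = q" "M $ 2 $ 2 = - 1"
    using assms by (auto simp: admissible_matrices_def q_def)
  define \<mu> where "\<mu> = 2 * a\<^sup>2"
  define lam where "lam = 2 * (\<mu> * \<delta>\<^sup>2 + 4 * a\<^sup>2)"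
  define r where "r = lam * \<bar>p\<bar> + 2 * lam * q\<^sup>2 + 4"
  have nn: "0 \<le> \<mu>" "0 \<le> lam" "0 \<le> r"
    by (auto simp: \<mu>_def lam_def r_def)
  have key: "(- r + lam * p) * x1\<^sup>2 + 2 * (lam * q) * x1 * x2 + (\<mu> * \<delta>\<^sup>2 - lam) * x2\<^sup>2
      - 2 * x1 * x3 + 2 * a * x2 * x3 - x3\<^sup>2 + 2 * a * x3 * x4 - \<mu> * x4\<^sup>2 \<le> 0"
    (is "?Q \<le> 0") for x1 x2 x3 x4 :: real
  proof -
    have "?Q = - lam * (\<bar>p\<bar> - p) * x1\<^sup>2 - lam / 2 * (2 * q * x1 - x2)\<^sup>2 - 2 * (a * x2 + x1)\<^sup>2
        - (x3 - 2 * (a * x2 - x1))\<^sup>2 / 2 - (x3 - 2 * a * x4)\<^sup>2 / 2"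
      unfolding r_def lam_def \<mu>_def by (simp add: field_simps power2_eq_square)
    moreover have "0 \<le> lam * (\<bar>p\<bar> - p) * x1\<^sup>2"
      using nn by auto
    moreover have "0 \<le> lam / 2 * (2 * q * x1 - x2)\<^sup>2"
      using nn by auto
    ultimately show ?thesis
      by (smt (verit) zero_le_power2 divide_nonneg_pos mult_minus_left mult_eq_0_iff)
  qed
  have "negative_semidefinite (lmi_matrix m \<delta> a M (sqrt r) lam \<mu> 0)"
    unfolding negative_semidefinite_def
  proof (intro conjI allI)
    show "transpose (lmi_matrix m \<delta> a M (sqrt r) lam \<mu> 0) = lmi_matrix m \<delta> a M (sqrt r) lam \<mu> 0"
      by (simp add: vec_eq_iff forall_4 transpose_def lmi_matrix_def vector_4 M q_def)
    show "x \<bullet> (lmi_matrix m \<delta> a M (sqrt r) lam \<mu> 0 *v x) \<le> 0" for x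
      using key[of "x $ 1" "x $ 2" "x $ 3" "x $ 4"] nn
      by (simp add: inner_vec_def matrix_vector_mult_def sum_4 lmi_matrix_def vector_4 M
          flip: p_def q_def) (simp add: algebra_simps power2_eq_square)
  qed
  then have "(sqrt r, lam, \<mu>, 0) \<in> feasible_tuples m \<delta> M a"
    using nn by (simp add: feasible_tuples_def)
  then show ?thesis by blast
qed

end

theory Submission
  imports Defs
begin

text \<open>Each map \<open>u \<mapsto> \<rho>\<^sup>2 u + 2 \<lambda> G\<^sup>2 + \<mu> c\<^sup>2\<close> is nondecreasing and continuous, so it commutes with
  infima of nonempty sets that are bounded below. Hence the infimum over the values reachable
  after \<open>k + 1\<close> steps, taken first over the values reachable after \<open>k\<close> steps and then over the
  last tuple, is the infimum over the last tuple applied to \<open>U\<^sub>k\<^sup>o\<^sup>p\<^sup>t\<close>.\<close>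

text \<open>The map is affine in \<open>u\<close> with slope \<open>\<rho>\<^sup>2\<close>, a
  square, hence nondecreasing for every real tuple.\<close>

lemma bound_step_Inf:
  assumes "S \<noteq> {}" "bdd_below S"
  shows "bound_step G c (Inf S) \<theta> = (INF u\<in>S. bound_step G c u \<theta>)"
proof -
  obtain \<rho> lam \<mu> \<nu> where \<theta>: "\<theta> = (\<rho>, lam, \<mu>, \<nu>)"
    by (cases \<theta>)
  have "mono (\<lambda>u. bound_step G c u \<theta>)"
    by (auto intro!: monoI mult_left_mono simp: \<theta> bound_step_def)
  moreover have "continuous (at_right (Inf S)) (\<lambda>u. bound_step G c u \<theta>)"
    by (auto simp: \<theta> bound_step_def intro!: continuous_intros)
  ultimately show ?thesis
    using assms by (rule continuous_at_Inf_mono)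
qed

text \<open>Peeling off the last step makes each set a union over the final tuple, which an infimum
  can be split along; the trajectories in \<open>U_opt\<close> do not show this structure
  directly.\<close>

primrec reachable ::
  "real \<Rightarrow> real \<Rightarrow> (nat \<Rightarrow> (real \<times> real \<times> real \<times> real) set) \<Rightarrow> real \<Rightarrow> nat \<Rightarrow> real set" where
  "reachable G c T U0 0 = {U0}"
| "reachable G c T U0 (Suc k) =
    (\<Union>\<theta>\<in>T k. (\<lambda>u. bound_step G c u \<theta>) ` reachable G c T U0 k)"

lemma reachable_eq_trajectories:
  "reachable G c T U0 k = {U k | U \<theta>. U 0 = U0 \<and>
      (\<forall>t<k. \<theta> t \<in> T t \<and> U (Suc t) = bound_step G c (U t) (\<theta> t))}"
proof (induction k)
  case 0
  show ?case
    by auto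
next
  case (Suc k)
  show ?case (is "_ = ?R")
  proof (intro equalityI subsetI)
    fix v assume "v \<in> reachable G c T U0 (Suc k)"
    then obtain \<tau> U \<theta> where \<tau>: "\<tau> \<in> T k" and v: "v = bound_step G c (U k) \<tau>" and "U 0 = U0"
      and "\<forall>t<k. \<theta> t \<in> T t \<and> U (Suc t) = bound_step G c (U t) (\<theta> t)"
      unfolding reachable.simps Suc.IH by blast
    \<comment> \<open>Overwriting \<open>U\<close> at \<open>Suc k\<close> and
      \<open>\<theta>\<close> at \<open>k\<close> leaves the first \<open>k\<close> steps intact and
      appends the step with \<open>\<tau>\<close>.\<close>
    then show "v \<in> ?R"
      by (auto simp: less_Suc_eq intro!: exI[of _ "U(Suc k := v)"] exI[of _ "\<theta>(k := \<tau>)"])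
  next
    fix v assume "v \<in> ?R"
    then obtain U \<theta> where v: "v = U (Suc k)" and "U 0 = U0"
      and step: "\<forall>t<Suc k. \<theta> t \<in> T t \<and> U (Suc t) = bound_step G c (U t) (\<theta> t)"
      by blast
    then have "U k \<in> reachable G c T U0 k"
      unfolding Suc.IH mem_Collect_eq by (intro exI[of _ U] exI[of _ \<theta>]) simp
    with v step show "v \<in> reachable G c T U0 (Suc k)"
      by auto
  qed
qed

text \<open>At \<open>0\<close> this is the infimum of a singleton; at \<open>Suc n\<close> the
  range \<open>t \<le> n\<close> in \<open>U_opt\<close> is \<open>t < Suc n\<close> for
  trajectories.\<close>

lemma U_opt_eq_Inf_reachable: "U_opt G c T U0 k = Inf (reachable G c T U0 k)"
proof (cases k)
  case 0
  then show ?thesis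
    by simp
next
  case (Suc n)
  show ?thesis
    unfolding Suc reachable_eq_trajectories less_Suc_eq_le by simp
qed

lemma reachable_nonempty:
  assumes "\<And>t. T t \<noteq> {}"
  shows "reachable G c T U0 k \<noteq> {}"
  using assms by (induction k) (auto simp del: split_paired_Ex simp: ex_in_conv)

text \<open>Supplies the lower bound under which real infima behave as expected: a step scales by a
  square and adds nonnegative terms.\<close>

lemma reachable_nonneg:
  assumes "U0 \<ge> 0" "\<And>t. T t \<subseteq> UNIV \<times> {0..} \<times> {0..} \<times> UNIV"
    and "u \<in> reachable G c T U0 k"
  shows "0 \<le> u"
  using assms(3)
proof (induction k arbitrary: u)
  case 0
  then show ?case
    using assms(1) by simp
next
  case (Suc k)
  then obtain \<rho> lam \<mu> \<nu> v where *: "(\<rho>, lam, \<mu>, \<nu>) \<in> T k" "v \<in> reachable G c T U0 k"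
    "u = bound_step G c v (\<rho>, lam, \<mu>, \<nu>)"
    by auto
  then show ?case
    using Suc.IH[of v] assms(2)[of k] by (auto simp: bound_step_def)
qed

text \<open>The matrix inequality is abstracted to nonempty sets of tuples with nonnegative
  \<open>lam\<close> and \<open>\<mu>\<close>.\<close>

lemma U_opt_Suc_eq_INF:
  assumes "U0 \<ge> 0" "\<And>t. T t \<noteq> {}"
    and "\<And>t. T t \<subseteq> UNIV \<times> {0..} \<times> {0..} \<times> UNIV"
  shows "U_opt G c T U0 (Suc k) = (INF \<theta>\<in>T k. bound_step G c (U_opt G c T U0 k) \<theta>)"
proof -
  let ?R = "reachable G c T U0"
  have ne: "?R n \<noteq> {}" for n
    using assms(2) by (rule reachable_nonempty)
  have bdd: "bdd_below (?R n)" for n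
    using reachable_nonneg[of U0 T, OF assms(1,3)] by (rule bdd_belowI)
  \<comment> \<open>The infimum over a union is iterated: each piece is nonempty, and
    \<open>bdd\<close> at \<open>Suc k\<close> bounds the whole union. The identity in
    \<open>v\<close> matches the shape of \<open>cINF_UNION\<close>.\<close>
  have "Inf (?R (Suc k)) = (INF \<theta>\<in>T k. INF v\<in>(\<lambda>u. bound_step G c u \<theta>) ` ?R k. v)"
    using cINF_UNION[of "T k" "\<lambda>\<theta>. (\<lambda>u. bound_step G c u \<theta>) ` ?R k" "\<lambda>v. v"]
      assms(2) ne[of k] bdd[of "Suc k"]
    by (simp add: image_UN)
  also have "\<dots> = (INF \<theta>\<in>T k. bound_step G c (Inf (?R k)) \<theta>)"
    by (simp add: bound_step_Inf[OF ne bdd])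
  finally show ?thesis
    by (simp only: U_opt_eq_Inf_reachable)
qed

text \<open>Both sequences start at \<open>U0\<close> and obey the same one-step recursion.\<close>

lemma U_greedy_eq_U_opt:
  assumes "U0 \<ge> 0" "\<And>t. T t \<noteq> {}"
    and "\<And>t. T t \<subseteq> UNIV \<times> {0..} \<times> {0..} \<times> UNIV"
  shows "U_greedy G c T U0 k = U_opt G c T U0 k"
proof (induction k)
  case 0
  show ?case
    by simp
next
  case (Suc k)
  show ?case
    using U_opt_Suc_eq_INF[of U0 T, OF assms] Suc.IH by simp
qed

theorem proposition1:
  fixes m L \<delta> c G U0 :: real
    and \<alpha> :: "nat \<Rightarrow> real"
    and M :: "real^2^2"
    and T :: "nat \<Rightarrow> (real \<times> real \<times> real \<times> real) set"
    and P :: "'w measure"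
    and x0 :: "'w \<Rightarrow> 'v::euclidean_space"
    and xstar :: 'v
  assumes "m > 0" and "L > 0" and "\<delta> \<ge> 0" and "c \<ge> 0" and "G \<ge> 0"
    and "\<And>k. \<alpha> k > 0"
    and "M \<in> admissible_matrices m L"
    and T_def: "\<And>k. T k = feasible_tuples m \<delta> M (\<alpha> k)"
    and "prob_space P"
    and "x0 \<in> borel_measurable P"
    and "integrable P (\<lambda>w. (norm (x0 w - xstar))\<^sup>2)"
    and "U0 \<ge> prob_space.expectation P (\<lambda>w. (norm (x0 w - xstar))\<^sup>2)"
  shows "(\<forall>k. U_opt G c T U0 (Suc k) =
            (INF (\<rho>, lam, \<mu>, \<nu>)\<in>T k. \<rho>\<^sup>2 * U_opt G c T U0 k + 2 * lam * G\<^sup>2 + \<mu> * c\<^sup>2))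
       \<and> (\<forall>k. U_greedy G c T U0 k = U_opt G c T U0 k)"
proof -
  have "0 \<le> prob_space.expectation P (\<lambda>w. (norm (x0 w - xstar))\<^sup>2)"
    by simp
  then have U0: "U0 \<ge> 0"
    using assms(12) by linarith
  have ne: "T t \<noteq> {}" for t
    unfolding T_def using assms(7) by (rule feasible_tuples_nonempty)
  have nonneg: "T t \<subseteq> UNIV \<times> {0..} \<times> {0..} \<times> UNIV" for t
    by (auto simp: T_def feasible_tuples_def)
  show ?thesis
    using U_opt_Suc_eq_INF[of U0 T, OF U0 ne nonneg, unfolded bound_step_def]
      U_greedy_eq_U_opt[of U0 T, OF U0 ne nonneg]
    by blast
qed

end
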